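(* Let $t\ge 1$ be an integer. For every $\varepsilon>0$ there exist $\delta>0$ and $n_0$ such that the following holds for every $n\ge n_0$. If $\overrightarrow{G}$ is an $n$-vertex oriented graph that does not contain $\overrightarrow{P_3(t)}$ as a subgraph and has at least $n^2/4-\delta n^2$ arcs, then $\overrightarrow{G}$ can be turned into the antidirected $K_{\lfloor n/2\rfloor,\lceil n/2\rceil}$ (on the same vertex set) by deleting, adding and reorienting at most $\varepsilon n^2$ arcs in total.
   Context: An oriented graph is a directed graph with no loops, no multiple arcs and no pair of opposite arcs. $\overrightarrow{P_3(t)}$ is the $t$-blow-up of the directed path on three vertices: it has three disjoint vertex sets $X,Y,Z$, each of size $t$, and arcs $\overrightarrow{xy}$ for all $x\in X,y\in Y$ and $\overrightarrow{yz}$ for all $y\in Y,z\in Z$. The antidirected $K_{\lfloor n/2\rfloor,\lceil n/2\rceil}$ is the complete bipartite graph with parts of sizes $\lfloor n/2\rfloor$ and $\lceil n/2\rceil$ in which all edges are oriented from one part to the other. *)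

theory Defs
  imports Complex_Main "Graph_Theory.Graph_Theory"
begin

definition oriented_graph :: "'a pair_pre_digraph \<Rightarrow> bool" where
  "oriented_graph G \<longleftrightarrow>
     pair_digraph G \<and> (\<forall>u v. (u, v) \<in> parcs G \<longrightarrow> (v, u) \<notin> parcs G)"

definition is_P3_blowup :: "nat \<Rightarrow> 'a pair_pre_digraph \<Rightarrow> bool" where
  "is_P3_blowup t H \<longleftrightarrow>
     (\<exists>X Y Z. finite X \<and> finite Y \<and> finite Z \<and>
        card X = t \<and> card Y = t \<and> card Z = t \<and>
        X \<inter> Y = {} \<and> X \<inter> Z = {} \<and> Y \<inter> Z = {} \<and>
        pverts H = X \<union> Y \<union> Z \<and> parcs H = X \<times> Y \<union> Y \<times> Z)"

definition contains_P3_blowup :: "nat \<Rightarrow> 'a pair_pre_digraph \<Rightarrow> bool" where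
  "contains_P3_blowup t G \<longleftrightarrow>
     (\<exists>H. is_P3_blowup t H \<and> subgraph (with_proj H) (with_proj G))"

text \<open>For odd \<open>n\<close> the arcs may go from the smaller part to the larger one or vice versa.\<close>

definition is_antidirected_balanced_bipartite :: "nat \<Rightarrow> 'a pair_pre_digraph \<Rightarrow> bool" where
  "is_antidirected_balanced_bipartite n K \<longleftrightarrow>
     (\<exists>B C. finite B \<and> finite C \<and> card B = n div 2 \<and> card C = (n + 1) div 2 \<and>
        B \<inter> C = {} \<and> pverts K = B \<union> C \<and>
        (parcs K = B \<times> C \<or> parcs K = C \<times> B))"

text \<open>
  \<open>D\<close>, \<open>R\<close> and \<open>N\<close> are the sets of deleted, reoriented and added arcs; reorienting
  an arc counts as one modification.
\<close>

definition editable_within :: "real \<Rightarrow> 'a pair_pre_digraph \<Rightarrow> 'a pair_pre_digraph \<Rightarrow> bool" where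
  "editable_within m G K \<longleftrightarrow>
     pverts K = pverts G \<and>
     (\<exists>D R N. D \<subseteq> parcs G \<and> R \<subseteq> parcs G \<and> D \<inter> R = {} \<and> finite N \<and> N \<inter> parcs G = {} \<and>
        parcs K = (parcs G - (D \<union> R)) \<union> R\<inverse> \<union> N \<and>
        real (card D + card R + card N) \<le> m)"

end

theory Submission
  imports Defs
begin

text \<open>
  If linearly many vertices had both linear in-degree and linear out-degree, then counting triples
  \<open>(X, y, Z)\<close> with \<open>X\<close>, \<open>Z\<close> \<open>t\<close>-subsets of the in- and out-neighbourhood of \<open>y\<close> would give a pair
  \<open>(X, Z)\<close> shared by \<open>t\<close> vertices, that is, a blow-up of the path. So almost every vertex has small
  in-degree or small out-degree. With \<open>A\<close> the set of vertices of small in-degree, almost all arcs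
  lead from \<open>A\<close> to its complement; since there are nearly \<open>n\<^sup>2 / 4\<close> arcs, \<open>A\<close> has nearly \<open>n / 2\<close>
  vertices and almost all pairs in \<open>A \<times> (V - A)\<close> are arcs.
\<close>

section \<open>Oriented graphs and blow-ups of the path\<close>

lemma oriented_graph_finite_verts: "oriented_graph G \<Longrightarrow> finite (pverts G)"
  by (simp add: oriented_graph_def pair_digraph_def pair_fin_digraph.pair_finite_verts)

lemma oriented_graph_wf: "oriented_graph G \<Longrightarrow> pair_wf_digraph G"
  by (simp add: oriented_graph_def pair_digraph_def pair_fin_digraph_def)

lemma oriented_graph_parcs_subset:
  assumes "oriented_graph G"
  shows "parcs G \<subseteq> pverts G \<times> pverts G"
  using pair_wf_digraph.arc_fst_in_verts[OF oriented_graph_wf[OF assms]]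
    pair_wf_digraph.arc_snd_in_verts[OF oriented_graph_wf[OF assms]]
  by force

lemma oriented_graph_antisym: "oriented_graph G \<Longrightarrow> (u, v) \<in> parcs G \<Longrightarrow> (v, u) \<notin> parcs G"
  by (simp add: oriented_graph_def)

text \<open>Disjointness of the three classes comes for free: a vertex shared by consecutive classes
  would be a loop, and one shared by \<open>X\<close> and \<open>Z\<close> would form opposite arcs
  with any vertex of \<open>Y\<close>. Nonemptiness, from \<open>t \<ge> 1\<close>, supplies the
  vertices this needs.\<close>

lemma contains_P3_blowupI:
  assumes G: "oriented_graph G"
    and fin: "finite X" "finite Y" "finite Z"
    and cards: "card X = t" "card Y = t" "card Z = t" "t \<ge> 1"
    and arcs: "X \<times> Y \<subseteq> parcs G" "Y \<times> Z \<subseteq> parcs G"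
  shows "contains_P3_blowup t G"
proof -
  let ?H = "\<lparr>pverts = X \<union> Y \<union> Z, parcs = X \<times> Y \<union> Y \<times> Z\<rparr>"
  note anti = oriented_graph_antisym[OF G]
  have ne: "X \<noteq> {}" "Y \<noteq> {}" "Z \<noteq> {}"
    using cards by auto
  have disj: "X \<inter> Y = {}" "X \<inter> Z = {}" "Y \<inter> Z = {}"
    using arcs anti ne by blast+
  then have "is_P3_blowup t ?H"
    unfolding is_P3_blowup_def using fin cards by (intro exI[of _ X] exI[of _ Y] exI[of _ Z]) simp
  moreover have "subgraph (with_proj ?H) (with_proj G)"
  proof -
    have "pair_wf_digraph ?H"
      by unfold_locales auto
    moreover have "X \<union> Y \<union> Z \<subseteq> pverts G"
      using arcs ne oriented_graph_parcs_subset[OF G] by blast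
    ultimately show ?thesis
      using arcs oriented_graph_wf[OF G]
      by (simp add: subgraph_def compatible_def wf_digraph_wp_iff)
  qed
  ultimately show ?thesis
    unfolding contains_P3_blowup_def by blast
qed

section \<open>Counting vertices with large in-degree and large out-degree\<close>

lemma contains_P3_blowup_if_many_mixed_vertices:
  assumes G: "oriented_graph G" and t: "t \<ge> 1" and S: "S \<subseteq> pverts G"
    and deg_in: "\<And>y. y \<in> S \<Longrightarrow> k \<le> card ((parcs G)\<inverse> `` {y})"
    and deg_out: "\<And>y. y \<in> S \<Longrightarrow> k \<le> card (parcs G `` {y})"
    and many: "t * (card (pverts G) choose t)\<^sup>2 < card S * (k choose t)\<^sup>2"
  shows "contains_P3_blowup t G"
proof (rule ccontr)
  assume contra: "\<not> contains_P3_blowup t G"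
  let ?V = "pverts G" and ?E = "parcs G"
  define P where "P = {T. T \<subseteq> ?V \<and> card T = t}"
  define R where "R = (\<lambda>(X, Z) y. X \<subseteq> ?E\<inverse> `` {y} \<and> Z \<subseteq> ?E `` {y})"
  note EV = oriented_graph_parcs_subset[OF G]
  have finV: "finite ?V"
    using G by (rule oriented_graph_finite_verts)
  have finP: "finite P"
    unfolding P_def using finV by simp
  have finS: "finite S"
    using S finV finite_subset by blast
  \<comment> \<open>Any \<open>t\<close> vertices related to the same pair serve as the middle class
    between \<open>X\<close> and \<open>Z\<close>.\<close>
  have upper: "card {y \<in> S. R p y} \<le> t" if pP: "p \<in> P \<times> P" for p
  proof (rule ccontr)
    obtain X Z where p: "p = (X, Z)" "X \<in> P" "Z \<in> P"
      using pP by blast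
    assume "\<not> ?thesis"
    then obtain Y where Y: "Y \<subseteq> {y \<in> S. R p y}" "card Y = t" "finite Y"
      using obtain_subset_with_card_n[of t "{y \<in> S. R p y}"] by auto
    have "X \<times> Y \<subseteq> ?E" "Y \<times> Z \<subseteq> ?E"
      using Y p unfolding R_def by auto
    moreover have "finite X" "finite Z" "card X = t" "card Z = t"
      using p finV finite_subset unfolding P_def by auto
    ultimately show False
      using contains_P3_blowupI[OF G] Y t contra by blast
  qed
  have lower: "(k choose t)\<^sup>2 \<le> card {p \<in> P \<times> P. R p y}" if y: "y \<in> S" for y
  proof -
    let ?I = "?E\<inverse> `` {y}" and ?O = "?E `` {y}"
    have sub: "?I \<subseteq> ?V" "?O \<subseteq> ?V"
      using EV by auto
    have fin: "finite ?I" "finite ?O"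
      using sub finV finite_subset by blast+
    \<comment> \<open>The two \<open>t\<close>-sets are chosen independently inside the
      neighbourhoods of \<open>y\<close>, so the count is a product of binomial
      coefficients.\<close>
    have eq: "{p \<in> P \<times> P. R p y} = {T. T \<subseteq> ?I \<and> card T = t} \<times> {T. T \<subseteq> ?O \<and> card T = t}"
      using sub unfolding P_def R_def by auto
    have "(k choose t)\<^sup>2 \<le> (card ?I choose t) * (card ?O choose t)"
      unfolding power2_eq_square
      by (intro mult_mono binomial_right_mono deg_in[OF y] deg_out[OF y]) auto
    then show ?thesis
      unfolding eq by (simp add: card_cartesian_product n_subsets fin)
  qed
  have "card S * (k choose t)\<^sup>2 \<le> (\<Sum>y\<in>S. card {p \<in> P \<times> P. R p y})"
    using sum_mono[of S "\<lambda>_. (k choose t)\<^sup>2", OF lower] by simp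
  also have "\<dots> = (\<Sum>p\<in>P \<times> P. card {y \<in> S. R p y})"
    by (rule sum_multicount_gen[symmetric]) (use finP finS in auto)
  also have "\<dots> \<le> card (P \<times> P) * t"
    using sum_mono[of "P \<times> P" _ "\<lambda>_. t", OF upper] by simp
  also have "\<dots> = t * (card ?V choose t)\<^sup>2"
    by (simp add: card_cartesian_product P_def n_subsets finV power2_eq_square)
  finally show False
    using many by simp
qed

text \<open>Both sides of the counting condition are of polynomial size: more than \<gamma> n mixed
  vertices give a left count of order n^(2t+1), against at most t n^(2t) on the other side.\<close>

lemma few_mixed_vertices:
  fixes t :: nat and \<gamma> :: real
  assumes t: "t \<ge> 1" and \<gamma>: "\<gamma> > 0"
  shows "\<exists>n\<^sub>0::nat. \<forall>n\<ge>n\<^sub>0. \<forall>G :: 'a pair_pre_digraph.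
    oriented_graph G \<and> card (pverts G) = n \<and> \<not> contains_P3_blowup t G \<longrightarrow>
    card {y \<in> pverts G. \<gamma> * n \<le> card ((parcs G)\<inverse> `` {y}) \<and> \<gamma> * n \<le> card (parcs G `` {y})} \<le> \<gamma> * n"
proof -
  \<comment> \<open>Chosen so that c n (n^t)^2 is exactly \<gamma> n ((\<gamma> n / t)^t)^2, the
    lower bound for the number of triples.\<close>
  define c where "c = \<gamma> * ((\<gamma> / t) ^ t)\<^sup>2"
  have c: "c > 0"
    using t \<gamma> by (simp add: c_def)
  \<comment> \<open>The three summands secure t <= n, t < \<gamma> n and t < c n respectively, for
    all n from the threshold on.\<close>
  obtain n\<^sub>0 :: nat where n0: "t + t / \<gamma> + t / c < n\<^sub>0"
    using reals_Archimedean2 by blast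
  show ?thesis
  proof (intro exI[of _ n\<^sub>0] allI impI, rule ccontr)
    fix n :: nat and G :: "'a pair_pre_digraph"
    let ?S = "{y \<in> pverts G. \<gamma> * n \<le> card ((parcs G)\<inverse> `` {y}) \<and> \<gamma> * n \<le> card (parcs G `` {y})}"
    assume n: "n\<^sub>0 \<le> n"
      and G: "oriented_graph G \<and> card (pverts G) = n \<and> \<not> contains_P3_blowup t G"
      and big: "\<not> card ?S \<le> \<gamma> * n"
    have n_gt: "t + t / \<gamma> + t / c < n"
      using n n0 by linarith
    have pos: "t / \<gamma> \<ge> 0" "t / c \<ge> 0"
      using \<gamma> c by simp_all
    have nt: "t \<le> n" and "t / \<gamma> < n" and "t / c < n"
      using n_gt pos by linarith+
    then have \<gamma>n: "t < \<gamma> * n" and cn: "t < c * n"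
      using \<gamma> c by (simp_all add: field_simps)
    \<comment> \<open>Degrees are integers, so the real threshold \<gamma> n may be rounded up
      without losing any vertex.\<close>
    define k where "k = nat \<lceil>\<gamma> * n\<rceil>"
    have k_le: "k \<le> m" if "\<gamma> * n \<le> m" for m :: nat
      using that unfolding k_def by linarith
    have k_ge: "\<gamma> * n \<le> k"
      unfolding k_def by linarith
    have tk: "t \<le> k"
      using k_ge \<gamma>n by linarith
    have "real (t * (n choose t)\<^sup>2) \<le> t * (real n ^ t)\<^sup>2"
      using binomial_le_pow[OF nt] by (simp add: power_mono mult_left_mono flip: of_nat_power)
    also have "\<dots> < c * n * (real n ^ t)\<^sup>2"
      using cn nt t by (intro mult_strict_right_mono) auto
    also have "\<dots> = \<gamma> * n * ((\<gamma> * n / t) ^ t)\<^sup>2"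
      unfolding c_def by (simp add: power_mult_distrib power_divide field_simps)
    also have "\<dots> \<le> card ?S * (real (k choose t))\<^sup>2"
    proof (intro mult_mono power_mono)
      have "(\<gamma> * n / t) ^ t \<le> (real k / real t) ^ t"
        using k_ge \<gamma> by (intro power_mono divide_right_mono) auto
      also have "\<dots> \<le> k choose t"
        by (rule binomial_ge_n_over_k_pow_k[OF tk])
      finally show "(\<gamma> * n / t) ^ t \<le> k choose t" .
    qed (use big \<gamma> in auto)
    also have "\<dots> = real (card ?S * (k choose t)\<^sup>2)"
      by simp
    finally have "t * (n choose t)\<^sup>2 < card ?S * (k choose t)\<^sup>2"
      by (simp only: of_nat_less_iff)
    then have "contains_P3_blowup t G"
      using G t by (intro contains_P3_blowup_if_many_mixed_vertices[of G t ?S k]) (auto intro: k_le)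
    then show False
      using G by blast
  qed
qed

section \<open>Almost all arcs cross one cut\<close>

text \<open>An arc that does not lead from \<open>A\<close> to its complement has its head in
  \<open>A\<close>, or its tail is mixed, or its tail lies in the remaining set. Each case accounts
  for at most \<gamma> n^2 arcs: by small in-degrees, by the scarcity of mixed vertices, and by
  small out-degrees.\<close>

lemma card_arcs_outside_cut_le:
  fixes G :: "'a pair_pre_digraph" and n :: nat and \<gamma> :: real
  assumes G: "oriented_graph G" and n: "card (pverts G) = n" and \<gamma>: "\<gamma> \<ge> 0"
    and S: "card {y \<in> pverts G. \<gamma> * n \<le> card ((parcs G)\<inverse> `` {y}) \<and> \<gamma> * n \<le> card (parcs G `` {y})} \<le> \<gamma> * n"
    (is "real (card ?S) \<le> _")
  defines "A \<equiv> {y \<in> pverts G. card ((parcs G)\<inverse> `` {y}) < \<gamma> * n}"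
  shows "card (parcs G - A \<times> (pverts G - A)) \<le> 3 * \<gamma> * (real n)\<^sup>2"
proof -
  let ?V = "pverts G" and ?E = "parcs G"
  \<comment> \<open>Outside \<open>A\<close> the in-degree reaches \<gamma> n, so a vertex there
    that is not mixed has out-degree below \<gamma> n.\<close>
  define B where "B = ?V - A - ?S"
  note EV = oriented_graph_parcs_subset[OF G]
  have finV: "finite ?V"
    using G by (rule oriented_graph_finite_verts)
  have fin_nb: "finite (?E\<inverse> `` {y})" "finite (?E `` {y})" for y
    using EV finV by (auto intro: finite_subset[of _ ?V])
  have A: "A \<subseteq> ?V" "finite A" and B: "B \<subseteq> ?V" "finite B" and finS: "finite ?S"
    using finV by (auto simp: A_def B_def)
  have sum_le: "(\<Sum>y\<in>T. card (N y)) \<le> \<gamma> * (real n)\<^sup>2"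
    if "T \<subseteq> ?V" "\<And>y. y \<in> T \<Longrightarrow> card (N y) \<le> \<gamma> * n" for T and N :: "'a \<Rightarrow> 'a set"
  proof -
    have "real (\<Sum>y\<in>T. card (N y)) \<le> card T * (\<gamma> * n)"
      using sum_mono[of T "\<lambda>y. real (card (N y))" "\<lambda>_. \<gamma> * n", OF that(2)] by simp
    also have "\<dots> \<le> n * (\<gamma> * n)"
      using card_mono[OF finV that(1)] n \<gamma> by (intro mult_right_mono) auto
    finally show ?thesis
      by (simp add: power2_eq_square mult_ac)
  qed
  let ?X = "\<Union>y\<in>A. ?E\<inverse> `` {y} \<times> {y}" and ?Y = "?S \<times> ?V" and ?Z = "SIGMA x:B. ?E `` {x}"
  have "?E - A \<times> (?V - A) \<subseteq> ?X \<union> ?Y \<union> ?Z"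
    using EV by (auto simp: B_def)
  then have "card (?E - A \<times> (?V - A)) \<le> card (?X \<union> ?Y \<union> ?Z)"
    using A B finS finV fin_nb by (intro card_mono) auto
  also have "\<dots> \<le> card ?X + card ?Y + card ?Z"
    using card_Un_le[of "?X \<union> ?Y" ?Z] card_Un_le[of ?X ?Y] by linarith
  finally have "real (card (?E - A \<times> (?V - A))) \<le> real (card ?X) + card ?Y + card ?Z"
    by linarith
  moreover have "card ?X \<le> \<gamma> * (real n)\<^sup>2"
  proof -
    have "card ?X \<le> (\<Sum>y\<in>A. card (?E\<inverse> `` {y}))"
      using card_UN_le[OF A(2), of "\<lambda>y. ?E\<inverse> `` {y} \<times> {y}"] by (simp add: card_cartesian_product)
    moreover have "(\<Sum>y\<in>A. card (?E\<inverse> `` {y})) \<le> \<gamma> * (real n)\<^sup>2"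
      by (rule sum_le[OF A(1)]) (auto simp: A_def)
    ultimately show ?thesis
      by linarith
  qed
  moreover have "card ?Y \<le> \<gamma> * (real n)\<^sup>2"
    using mult_right_mono[OF S, of n] n by (simp add: card_cartesian_product power2_eq_square mult_ac)
  moreover have "card ?Z \<le> \<gamma> * (real n)\<^sup>2"
  proof -
    have "card ?Z = (\<Sum>y\<in>B. card (?E `` {y}))"
      using B fin_nb by (intro card_SigmaI) auto
    moreover have "(\<Sum>y\<in>B. card (?E `` {y})) \<le> \<gamma> * (real n)\<^sup>2"
      by (rule sum_le[OF B(1)]) (auto simp: A_def B_def)
    ultimately show ?thesis
      by linarith
  qed
  ultimately show ?thesis
    by linarith
qed

section \<open>Balancing the cut and counting the edits\<close>

text \<open>Growing or shrinking \<open>A\<close> inside \<open>V\<close> to size \<open>m\<close>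
  keeps the two sets nested, which makes the symmetric difference as small as the sizes
  permit.\<close>

lemma exists_nested_subset_card:
  assumes "finite V" "A \<subseteq> V" "m \<le> card V"
  obtains B where "B \<subseteq> V" "card B = m"
    "real (card (A - B) + card (B - A)) = \<bar>real (card A) - real m\<bar>"
proof (cases "card A \<le> m")
  case True
  then obtain B where B: "A \<subseteq> B" "B \<subseteq> V" "card B = m"
    using exists_subset_between[OF True assms(3,2,1)] by blast
  moreover have "card (B - A) = m - card A"
    using B assms finite_subset card_Diff_subset[of A B] by blast
  moreover have "card (A - B) = 0"
    using B(1) by (metis Diff_eq_empty_iff card.empty)
  ultimately show ?thesis
    using that[of B] True by simp
next
  case False
  then obtain B where B: "B \<subseteq> A" "card B = m" "finite B"
    using obtain_subset_with_card_n[of m A] by auto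
  moreover have "card (A - B) = card A - m"
    using B card_Diff_subset[of B A] by auto
  moreover have "card (B - A) = 0"
    using B(1) by (metis Diff_eq_empty_iff card.empty)
  ultimately show ?thesis
    using that[of B] False assms by simp
qed

text \<open>An arc that crosses the cut of \<open>A\<close> but not that of \<open>B\<close> has its
  tail in \<open>A - B\<close> or its head in \<open>B - A\<close>; each such vertex accounts for at
  most \<open>card V\<close> arcs.\<close>

lemma card_diff_cut_le:
  assumes V: "finite V" "A \<subseteq> V" "B \<subseteq> V" and E: "E \<subseteq> V \<times> V"
  shows "card (E - B \<times> (V - B))
    \<le> card (E - A \<times> (V - A)) + (card (A - B) + card (B - A)) * card V"
proof -
  have fin: "finite A" "finite B" "finite E"
    using assms finite_subset by (blast intro: finite_cartesian_product)+
  have "E - B \<times> (V - B) \<subseteq> (E - A \<times> (V - A)) \<union> ((A - B) \<times> V \<union> V \<times> (B - A))"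
    using assms by auto
  then have "card (E - B \<times> (V - B)) \<le> card ((E - A \<times> (V - A)) \<union> ((A - B) \<times> V \<union> V \<times> (B - A)))"
    using fin V by (intro card_mono) auto
  also have "\<dots> \<le> card (E - A \<times> (V - A)) + (card ((A - B) \<times> V) + card (V \<times> (B - A)))"
    by (meson add_left_mono card_Un_le order_trans)
  finally show ?thesis
    by (simp add: card_cartesian_product algebra_simps)
qed

text \<open>Completing the square: a (n - a) = n^2/4 - (a - n/2)^2.\<close>

lemma deviation_from_half_le:
  fixes a n s :: real
  assumes "s \<ge> 0" "n \<ge> 0" "n\<^sup>2 / 4 - s\<^sup>2 * n\<^sup>2 \<le> a * (n - a)"
  shows "\<bar>a - n / 2\<bar> \<le> s * n"
proof -
  have "(a - n / 2)\<^sup>2 \<le> (s * n)\<^sup>2"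
    using assms(3) by (simp add: power2_eq_square field_simps)
  then show ?thesis
    using assms(1,2) by (simp add: abs_le_square_iff[symmetric])
qed

text \<open>No arc is reoriented: a wrongly directed arc is deleted and its reverse added, which
  costs two edits instead of one and affects only the constant.\<close>

lemma editable_within_cut:
  fixes G :: "'a pair_pre_digraph" and n :: nat and s :: real
  assumes G: "oriented_graph G" and n: "card (pverts G) = n" and s: "0 \<le> s" "s \<le> 1"
    and arcs: "card (parcs G) \<ge> (real n)\<^sup>2 / 4 - s\<^sup>2 * (real n)\<^sup>2"
    and A: "A \<subseteq> pverts G"
    and out: "card (parcs G - A \<times> (pverts G - A)) \<le> 3 * s\<^sup>2 * (real n)\<^sup>2"
  shows "\<exists>K. is_antidirected_balanced_bipartite n K \<and> editable_within (11 * s * (real n)\<^sup>2 + n) G K"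
proof -
  let ?V = "pverts G" and ?E = "parcs G"
  note EV = oriented_graph_parcs_subset[OF G]
  have finV: "finite ?V"
    using G by (rule oriented_graph_finite_verts)
  have finE: "finite ?E"
    using EV finV finite_subset by blast
  obtain B where B: "B \<subseteq> ?V" "card B = n div 2"
      "real (card (A - B) + card (B - A)) = \<bar>real (card A) - real (n div 2)\<bar>"
    using exists_nested_subset_card[OF finV A, of "n div 2"] n by (metis div_le_dividend)
  define C where "C = ?V - B"
  define K where "K = \<lparr>pverts = ?V, parcs = B \<times> C\<rparr>"
  have finB: "finite B" and finC: "finite C"
    using B finV finite_subset unfolding C_def by blast+
  have cardC: "card C = (n + 1) div 2"
    using card_Diff_subset[OF finB B(1)] B n unfolding C_def by linarith
  have "is_antidirected_balanced_bipartite n K"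
    unfolding is_antidirected_balanced_bipartite_def K_def
    by (intro exI[of _ B] exI[of _ C]) (use finB finC cardC B in \<open>auto simp: C_def\<close>)
  moreover have "editable_within (11 * s * (real n)\<^sup>2 + n) G K"
  proof -
    have finA: "finite A" and cardA: "card A \<le> n"
      using A finV n finite_subset card_mono by blast+
    have "card ?E \<le> card (A \<times> (?V - A) \<union> (?E - A \<times> (?V - A)))"
      using finA finV finE by (intro card_mono) auto
    also have "\<dots> \<le> card A * (n - card A) + card (?E - A \<times> (?V - A))"
      using card_Un_le[of "A \<times> (?V - A)" "?E - A \<times> (?V - A)"] card_Diff_subset[OF finA A] n
      by (simp add: card_cartesian_product)
    finally have "real (card ?E) \<le> real (card A * (n - card A)) + real (card (?E - A \<times> (?V - A)))"
      by linarith
    \<comment> \<open>The loss s^2 in the number of arcs and the 3 s^2 outside the cut add up to (2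
      s)^2.\<close>
    then have "(real n)\<^sup>2 / 4 - (2 * s)\<^sup>2 * (real n)\<^sup>2 \<le> card A * (real n - card A)"
      using arcs out cardA by (simp add: of_nat_diff)
    then have "\<bar>card A - real n / 2\<bar> \<le> 2 * s * n"
      using s by (intro deviation_from_half_le) auto
    moreover have "\<bar>real (n div 2) - real n / 2\<bar> \<le> 1 / 2"
      by linarith
    ultimately have "real (card (A - B) + card (B - A)) \<le> 2 * s * n + 1 / 2"
      using B(3) by linarith
    then have "real (card (A - B) + card (B - A)) * n \<le> (2 * s * n + 1 / 2) * n"
      by (intro mult_right_mono) auto
    moreover have "real (card (?E - B \<times> C))
        \<le> real (card (?E - A \<times> (?V - A))) + real (card (A - B) + card (B - A)) * n"
      using card_diff_cut_le[OF finV A B(1) EV] n unfolding C_def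
      by (metis of_nat_add of_nat_le_iff of_nat_mult)
    moreover have s2: "s\<^sup>2 * (real n)\<^sup>2 \<le> s * (real n)\<^sup>2"
      using s by (intro mult_right_mono) (auto simp: power2_eq_square mult_left_le)
    \<comment> \<open>The factor 5 is 3 from the arcs outside the cut of \<open>A\<close>, where s^2
      <= s, plus 2 from moving to \<open>B\<close>; the term n/2 is the rounding of n/2 to an
      integer.\<close>
    ultimately have del: "real (card (?E - B \<times> C)) \<le> 5 * s * (real n)\<^sup>2 + n / 2"
      using out by (simp add: power2_eq_square algebra_simps)
    have BC: "real (card (B \<times> C)) \<le> (real n)\<^sup>2 / 4"
    proof -
      have "n = card B + card C"
        using B(2) cardC by linarith
      then have "real n = card B + card C"
        by simp
      moreover have "0 \<le> (real (card B) - card C)\<^sup>2"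
        by simp
      ultimately show ?thesis
        by (simp add: card_cartesian_product power2_eq_square algebra_simps)
    qed
    \<comment> \<open>Both sides count the union of \<open>?E\<close> and
      \<open>B \<times> C\<close>. This bounds the additions by the deletions, since
      \<open>?E\<close> is hardly smaller than n^2/4.\<close>
    have "card (B \<times> C - ?E) + card ?E = card (?E - B \<times> C) + card (B \<times> C)"
    proof -
      have "card ?E = card (?E - B \<times> C) + card (?E \<inter> B \<times> C)"
        using finE card_Int_Diff by (metis add.commute)
      moreover have "card (B \<times> C) = card (B \<times> C - ?E) + card (?E \<inter> B \<times> C)"
        using finB finC card_Int_Diff by (metis add.commute finite_cartesian_product inf_commute)
      ultimately show ?thesis
        by linarith
    qed
    then have "real (card (B \<times> C - ?E)) + card ?E = real (card (?E - B \<times> C)) + card (B \<times> C)"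
      by (metis of_nat_add)
    \<comment> \<open>Deletions enter twice, giving 10 s n^2 + n; the deficit of at most s^2 n^2 <=
      s n^2 in the number of arcs brings the factor to 11.\<close>
    then have "real (card (?E - B \<times> C) + card ({} :: ('a \<times> 'a) set) + card (B \<times> C - ?E)) \<le> 11 * s * (real n)\<^sup>2 + n"
      using del BC arcs s2 by simp
    then show ?thesis
      unfolding editable_within_def K_def
      by (intro conjI exI[of _ "?E - B \<times> C"] exI[of _ "{}"] exI[of _ "B \<times> C - ?E"])
        (use finB finC in auto)
  qed
  ultimately show ?thesis
    by blast
qed

section \<open>Choice of the constants\<close>

lemma editable_within_mono: "editable_within m G K \<Longrightarrow> m \<le> m' \<Longrightarrow> editable_within m' G K"
  unfolding editable_within_def by (meson order_trans)

theorem theorem3p1: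
  fixes t :: nat and \<epsilon> :: real
  assumes "t \<ge> 1" and "\<epsilon> > 0"
  shows "\<exists>\<delta>>0. \<exists>n\<^sub>0::nat. \<forall>n\<ge>n\<^sub>0. \<forall>G :: 'a pair_pre_digraph.
           oriented_graph G \<and> card (pverts G) = n \<and>
           \<not> contains_P3_blowup t G \<and>
           real (card (parcs G)) \<ge> (real n)\<^sup>2 / 4 - \<delta> * (real n)\<^sup>2 \<longrightarrow>
           (\<exists>K. is_antidirected_balanced_bipartite n K \<and>
                editable_within (\<epsilon> * (real n)\<^sup>2) G K)"
proof -
  \<comment> \<open>Half of the budget \<epsilon> n^2 pays for 11 s n^2, the other half for the
    linear term once n > 2 / \<epsilon>. Both \<delta> and the degree threshold are taken as s^2,
    because the deviation of \<open>A\<close> from n/2 is of the order of their square root.\<close>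
  define s where "s = min 1 (\<epsilon> / 22)"
  have s: "0 < s" "s \<le> 1" "22 * s \<le> \<epsilon>"
    using assms(2) by (auto simp: s_def)
  obtain n\<^sub>1 :: nat where n1: "\<And>n (G :: 'a pair_pre_digraph). n\<^sub>1 \<le> n \<Longrightarrow>
      oriented_graph G \<and> card (pverts G) = n \<and> \<not> contains_P3_blowup t G \<Longrightarrow>
      card {y \<in> pverts G. s\<^sup>2 * n \<le> card ((parcs G)\<inverse> `` {y}) \<and> s\<^sup>2 * n \<le> card (parcs G `` {y})} \<le> s\<^sup>2 * n"
    using few_mixed_vertices[OF assms(1) zero_less_power[OF s(1), of 2], where 'a = 'a]
    by blast
  obtain n\<^sub>2 :: nat where n2: "2 / \<epsilon> < n\<^sub>2"
    using reals_Archimedean2 by blast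
  show ?thesis
  proof (intro exI[of _ "s\<^sup>2"] conjI exI[of _ "max n\<^sub>1 n\<^sub>2"] allI impI)
    show "0 < s\<^sup>2"
      using s by simp
    fix n :: nat and G :: "'a pair_pre_digraph"
    assume n: "max n\<^sub>1 n\<^sub>2 \<le> n"
      and G: "oriented_graph G \<and> card (pverts G) = n \<and> \<not> contains_P3_blowup t G \<and>
        real (card (parcs G)) \<ge> (real n)\<^sup>2 / 4 - s\<^sup>2 * (real n)\<^sup>2"
    let ?A = "{y \<in> pverts G. card ((parcs G)\<inverse> `` {y}) < s\<^sup>2 * n}"
    have "card (parcs G - ?A \<times> (pverts G - ?A)) \<le> 3 * s\<^sup>2 * (real n)\<^sup>2"
      using card_arcs_outside_cut_le[of G n "s\<^sup>2"] n1[of n G] n G by simp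
    then obtain K where K: "is_antidirected_balanced_bipartite n K"
        "editable_within (11 * s * (real n)\<^sup>2 + n) G K"
      using editable_within_cut[of G n s ?A] G s by auto
    have "2 / \<epsilon> < n"
      using n n2 by linarith
    then have "2 * real n \<le> \<epsilon> * n * n"
      using assms(2) by (intro mult_right_mono) (auto simp: field_simps)
    moreover have "22 * s * (real n)\<^sup>2 \<le> \<epsilon> * (real n)\<^sup>2"
      using s by (intro mult_right_mono) auto
    ultimately have "11 * s * (real n)\<^sup>2 + n \<le> \<epsilon> * (real n)\<^sup>2"
      by (simp add: power2_eq_square)
    then show "\<exists>K. is_antidirected_balanced_bipartite n K \<and> editable_within (\<epsilon> * (real n)\<^sup>2) G K"
      using K editable_within_mono by blast
  qed
qed

end
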